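(* Let $Y\sim N(0,1)$ be a standard normal random variable. For all integers $n\ge k\ge 0$, $${n \brace k}_{Y,\lambda}=\frac{1}{k!}\sum_{l=0}^{k}\binom{k}{l}(-1)^{k-l}\sum_{j=0}^{[n/2]}\frac{l^{j}(2j)!}{2^{j}j!}\sum_{m=2j}^{n}S_{1}(m,2j){n\brace m}_{\lambda}.$$
   Context: $\lambda$ is a fixed nonzero real number, $[n/2]$ denotes the integer part of $n/2$, and $0^0=1$. For real $x$ and $n\ge1$: $(x)_{n}=x(x-1)\cdots(x-n+1)$, $(x)_{n,\lambda}=x(x-\lambda)\cdots(x-(n-1)\lambda)$, and $(x)_0=(x)_{0,\lambda}=1$. The (signed) Stirling numbers of the first kind $S_1(n,k)$ and the degenerate Stirling numbers of the second kind ${n\brace k}_\lambda$ are defined by the polynomial identities $(x)_n=\sum_{k=0}^nS_1(n,k)x^k$ and $(x)_{n,\lambda}=\sum_{k=0}^n{n\brace k}_\lambda(x)_k$, $n\ge0$. The degenerate exponential is $e_{\lambda}^{x}(t)=(1+\lambda t)^{x/\lambda}=\sum_{n\ge0}(x)_{n,\lambda}\frac{t^n}{n!}$, and $E[e_{\lambda}^{Y}(t)]=\sum_{n\ge0}E[(Y)_{n,\lambda}]\frac{t^n}{n!}$ for $t$ near $0$. The probabilistic degenerate Stirling numbers of the second kind associated with $Y$ are defined by the power series expansion at $t=0$: $\frac{1}{k!}\big(E[e_{\lambda}^{Y}(t)]-1\big)^k=\sum_{n\ge k}{n\brace k}_{Y,\lambda}\frac{t^n}{n!}$, $k\ge0$.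 *)

theory Defs
  imports "HOL-Probability.Probability" "HOL-Complex_Analysis.Cauchy_Integral_Formula"
begin

definition falling_fact :: "real \<Rightarrow> nat \<Rightarrow> real" where
  "falling_fact x n = (\<Prod>i<n. x - real i)"

definition deg_falling_fact :: "real \<Rightarrow> real \<Rightarrow> nat \<Rightarrow> real" where
  "deg_falling_fact lam x n = (\<Prod>i<n. x - real i * lam)"

text \<open>The defining identities of both kinds of Stirling numbers only determine the entries
  with \<open>k \<le> n\<close>; the remaining entries are set to 0. Existence and uniqueness of the
  coefficient sequences are proved below.\<close>

definition signed_stirling1 :: "nat \<Rightarrow> nat \<Rightarrow> real" where
  "signed_stirling1 n = (THE c. (\<forall>x. falling_fact x n = (\<Sum>k\<le>n. c k * x ^ k)) \<and> (\<forall>k>n. c k = 0))"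

definition deg_stirling2 :: "real \<Rightarrow> nat \<Rightarrow> nat \<Rightarrow> real" where
  "deg_stirling2 lam n =
     (THE c. (\<forall>x. deg_falling_fact lam x n = (\<Sum>k\<le>n. c k * falling_fact x k)) \<and> (\<forall>k>n. c k = 0))"

text \<open>Only used for \<open>t\<close> near 0, where \<open>1 + lam * t > 0\<close> and \<open>powr\<close> is the usual real power.\<close>

definition deg_exp :: "real \<Rightarrow> real \<Rightarrow> real \<Rightarrow> real" where
  "deg_exp lam x t = (1 + lam * t) powr (x / lam)"

text \<open>The number is \<open>n!\<close> times the coefficient of \<open>t^n\<close> in the power series that converges to
  \<open>(E[deg_exp lam Y t] - 1)^k / k!\<close> near \<open>t = 0\<close>. Such a series is unique if it exists
  (see \<open>prob_deg_stirling2_eqI\<close>); otherwise the value is unspecified.\<close>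

definition prob_deg_stirling2 ::
  "'a measure \<Rightarrow> ('a \<Rightarrow> real) \<Rightarrow> real \<Rightarrow> nat \<Rightarrow> nat \<Rightarrow> real" where
  "prob_deg_stirling2 M Y lam n k =
     fact n * fps_nth (THE F. (\<lambda>t. 1 / fact k * ((LINT \<omega>|M. deg_exp lam (Y \<omega>) t) - 1) ^ k)
                                 has_fps_expansion F) n"

lemma falling_fact_0 [simp]: "falling_fact x 0 = 1"
  by (simp add: falling_fact_def)

lemma falling_fact_Suc: "falling_fact x (Suc n) = falling_fact x n * (x - real n)"
  by (simp add: falling_fact_def)

lemma deg_falling_fact_0 [simp]: "deg_falling_fact lam x 0 = 1"
  by (simp add: deg_falling_fact_def)

lemma deg_falling_fact_Suc:
  "deg_falling_fact lam x (Suc n) = deg_falling_fact lam x n * (x - real n * lam)"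
  by (simp add: deg_falling_fact_def)

lemma falling_fact_of_nat_eq_0: "m < k \<Longrightarrow> falling_fact (real m) k = 0"
  by (auto simp: falling_fact_def)

lemma falling_fact_of_nat_self: "falling_fact (real m) m \<noteq> 0"
  by (auto simp: falling_fact_def)

lemma falling_fact_coeffs_exist:
  "\<exists>c. (\<forall>x. falling_fact x n = (\<Sum>k\<le>n. c k * x ^ k)) \<and> (\<forall>k>n. c k = 0)"
proof (induction n)
  case 0
  show ?case by (intro exI[of _ "\<lambda>k. if k = 0 then 1 else 0"]) auto
next
  case (Suc n)
  then obtain c where c: "\<And>x. falling_fact x n = (\<Sum>k\<le>n. c k * x ^ k)" and z: "\<And>k. k > n \<Longrightarrow> c k = 0"
    by blast
  define d where "d = (\<lambda>k. (case k of 0 \<Rightarrow> 0 | Suc i \<Rightarrow> c i) - real n * c k)"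
  have "falling_fact x (Suc n) = (\<Sum>k\<le>Suc n. d k * x ^ k)" for x
  proof -
    have "(\<Sum>k\<le>Suc n. d k * x ^ k) =
        (\<Sum>k\<le>Suc n. (case k of 0 \<Rightarrow> 0 | Suc i \<Rightarrow> c i) * x ^ k) - real n * (\<Sum>k\<le>Suc n. c k * x ^ k)"
      by (simp add: d_def left_diff_distrib sum_subtractf sum_distrib_left mult.assoc del: sum.atMost_Suc)
    also have "(\<Sum>k\<le>Suc n. (case k of 0 \<Rightarrow> 0 | Suc i \<Rightarrow> c i) * x ^ k) = x * (\<Sum>k\<le>n. c k * x ^ k)"
      by (subst sum.atMost_Suc_shift) (simp add: sum_distrib_left mult_ac)
    also have "(\<Sum>k\<le>Suc n. c k * x ^ k) = (\<Sum>k\<le>n. c k * x ^ k)"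
      by (simp add: z)
    finally show ?thesis
      by (simp add: falling_fact_Suc c algebra_simps)
  qed
  moreover have "\<forall>k>Suc n. d k = 0"
    by (auto simp: d_def z split: nat.splits)
  ultimately show ?case by blast
qed

lemma falling_fact_coeffs_unique:
  fixes c d :: "nat \<Rightarrow> real"
  assumes "\<And>x. (\<Sum>k\<le>n. c k * x ^ k) = (\<Sum>k\<le>n. d k * x ^ k)" "k \<le> n"
  shows "c k = d k"
  using assms polyfun_eq_coeffs[of c n d] by blast

lemma falling_fact_conv_signed_stirling1:
  "falling_fact x n = (\<Sum>k\<le>n. signed_stirling1 n k * x ^ k)"
  and signed_stirling1_eq_0: "k > n \<Longrightarrow> signed_stirling1 n k = 0"
proof -
  let ?P = "\<lambda>c. (\<forall>x. falling_fact x n = (\<Sum>k\<le>n. c k * x ^ k)) \<and> (\<forall>k>n. c k = 0)"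
  have ex1: "\<exists>!c. ?P c"
  proof (rule ex_ex1I)
    show "\<exists>c. ?P c" by (rule falling_fact_coeffs_exist)
  next
    fix c d assume c: "?P c" and d: "?P d"
    show "c = d"
    proof
      fix k
      show "c k = d k"
      proof (cases "k \<le> n")
        case True
        have "(\<Sum>k\<le>n. c k * x ^ k) = (\<Sum>k\<le>n. d k * x ^ k)" for x
          using conjunct1[OF c, THEN spec, of x] conjunct1[OF d, THEN spec, of x] by (rule trans[OF sym])
        then show ?thesis
          using True by (rule falling_fact_coeffs_unique)
      next
        case False
        then show ?thesis using c d by simp
      qed
    qed
  qed
  have P: "?P (signed_stirling1 n)"
    unfolding signed_stirling1_def by (rule theI'[OF ex1])
  show "falling_fact x n = (\<Sum>k\<le>n. signed_stirling1 n k * x ^ k)"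
    using P by blast
  show "k > n \<Longrightarrow> signed_stirling1 n k = 0"
    using P by blast
qed

lemma deg_falling_fact_coeffs_exist:
  "\<exists>c. (\<forall>x. deg_falling_fact lam x n = (\<Sum>k\<le>n. c k * falling_fact x k)) \<and> (\<forall>k>n. c k = 0)"
proof (induction n)
  case 0
  show ?case by (intro exI[of _ "\<lambda>k. if k = 0 then 1 else 0"]) auto
next
  case (Suc n)
  then obtain c where c: "\<And>x. deg_falling_fact lam x n = (\<Sum>k\<le>n. c k * falling_fact x k)"
    and z: "\<And>k. k > n \<Longrightarrow> c k = 0"
    by blast
  define d where "d = (\<lambda>k. (case k of 0 \<Rightarrow> 0 | Suc i \<Rightarrow> c i) + (real k - real n * lam) * c k)"
  have "deg_falling_fact lam x (Suc n) = (\<Sum>k\<le>Suc n. d k * falling_fact x k)" for x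
  proof -
    have "(\<Sum>k\<le>Suc n. d k * falling_fact x k) =
        (\<Sum>k\<le>Suc n. (case k of 0 \<Rightarrow> 0 | Suc i \<Rightarrow> c i) * falling_fact x k) +
        (\<Sum>k\<le>Suc n. (real k - real n * lam) * c k * falling_fact x k)"
      by (simp add: d_def distrib_right sum.distrib del: sum.atMost_Suc)
    also have "(\<Sum>k\<le>Suc n. (case k of 0 \<Rightarrow> 0 | Suc i \<Rightarrow> c i) * falling_fact x k)
        = (\<Sum>k\<le>n. c k * (falling_fact x k * (x - real k)))"
      by (subst sum.atMost_Suc_shift) (simp add: falling_fact_Suc)
    also have "(\<Sum>k\<le>Suc n. (real k - real n * lam) * c k * falling_fact x k)
        = (\<Sum>k\<le>n. (real k - real n * lam) * c k * falling_fact x k)"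
      by (simp add: z)
    also have "(\<Sum>k\<le>n. c k * (falling_fact x k * (x - real k))) + \<dots>
        = (\<Sum>k\<le>n. c k * falling_fact x k) * (x - real n * lam)"
      unfolding sum.distrib [symmetric] sum_distrib_right
      by (intro sum.cong) (auto simp: algebra_simps)
    finally show ?thesis
      by (simp add: deg_falling_fact_Suc c)
  qed
  moreover have "\<forall>k>Suc n. d k = 0"
    by (auto simp: d_def z split: nat.splits)
  ultimately show ?case by blast
qed

lemma deg_falling_fact_coeffs_unique:
  fixes c d :: "nat \<Rightarrow> real"
  assumes eq: "\<And>x. (\<Sum>k\<le>n. c k * falling_fact x k) = (\<Sum>k\<le>n. d k * falling_fact x k)"
    and "k \<le> n"
  shows "c k = d k"
  using \<open>k \<le> n\<close>
proof (induction k rule: less_induct)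
  case (less m)
  have split: "(\<Sum>k\<le>n. b k * falling_fact (real m) k)
      = (\<Sum>k<m. b k * falling_fact (real m) k) + b m * falling_fact (real m) m"
    for b :: "nat \<Rightarrow> real"
  proof -
    have "(\<Sum>k\<le>n. b k * falling_fact (real m) k) = (\<Sum>k\<le>m. b k * falling_fact (real m) k)"
      using less.prems by (intro sum.mono_neutral_right) (auto simp: falling_fact_of_nat_eq_0)
    then show ?thesis by (simp add: lessThan_Suc_atMost [symmetric])
  qed
  have "(\<Sum>k<m. c k * falling_fact (real m) k) = (\<Sum>k<m. d k * falling_fact (real m) k)"
    using less by (intro sum.cong) auto
  with eq[of "real m"] show ?case
    by (simp add: split falling_fact_of_nat_self)
qed

lemma deg_falling_fact_conv_deg_stirling2:
  "deg_falling_fact lam x n = (\<Sum>k\<le>n. deg_stirling2 lam n k * falling_fact x k)"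
  and deg_stirling2_eq_0: "k > n \<Longrightarrow> deg_stirling2 lam n k = 0"
proof -
  let ?P = "\<lambda>c. (\<forall>x. deg_falling_fact lam x n = (\<Sum>k\<le>n. c k * falling_fact x k)) \<and> (\<forall>k>n. c k = 0)"
  have ex1: "\<exists>!c. ?P c"
  proof (rule ex_ex1I)
    show "\<exists>c. ?P c" by (rule deg_falling_fact_coeffs_exist)
  next
    fix c d assume c: "?P c" and d: "?P d"
    show "c = d"
    proof
      fix k
      show "c k = d k"
      proof (cases "k \<le> n")
        case True
        have "(\<Sum>k\<le>n. c k * falling_fact x k) = (\<Sum>k\<le>n. d k * falling_fact x k)" for x
          using conjunct1[OF c, THEN spec, of x] conjunct1[OF d, THEN spec, of x] by (rule trans[OF sym])
        then show ?thesis
          using True by (rule deg_falling_fact_coeffs_unique)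
      next
        case False
        then show ?thesis using c d by simp
      qed
    qed
  qed
  have P: "?P (deg_stirling2 lam n)"
    unfolding deg_stirling2_def by (rule theI'[OF ex1])
  show "deg_falling_fact lam x n = (\<Sum>k\<le>n. deg_stirling2 lam n k * falling_fact x k)"
    using P by blast
  show "k > n \<Longrightarrow> deg_stirling2 lam n k = 0"
    using P by blast
qed

lemma has_fps_expansion_unique_real:
  fixes f :: "real \<Rightarrow> real"
  assumes "f has_fps_expansion F" "f has_fps_expansion G"
  shows "F = G"
proof -
  define H where "H = F - G"
  have "(\<lambda>x. f x - f x) has_fps_expansion H"
    unfolding H_def by (intro has_fps_expansion_diff assms)
  then have radius: "fps_conv_radius H > 0" and ev: "eventually (\<lambda>x. eval_fps H x = 0) (nhds 0)"
    by (auto simp: has_fps_expansion_def)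
  have H0: "eval_fps H 0 = 0"
    using eventually_nhds_x_imp_x[OF ev] .
  obtain r where r: "r > 0" "ereal r < fps_conv_radius H"
    using ereal_dense2[OF radius] by (auto simp: zero_ereal_def)
  have "fps_nth H m = 0" for m
  proof (rule ccontr)
    assume m: "fps_nth H m \<noteq> 0"
    have "m > 0"
      using m H0 by (cases m) (auto simp: eval_fps_at_0)
    have sums: "(\<lambda>n. fps_nth H n * (x - 0) ^ n) sums eval_fps H x" if "norm (x - 0) < r" for x
    proof -
      have "ereal (norm x) < ereal r" using that by simp
      also note r(2)
      finally show ?thesis using sums_eval_fps[of x H] by simp
    qed
    obtain s where s: "s > 0" "\<And>z. z \<in> cball 0 s - {0} \<Longrightarrow> eval_fps H z \<noteq> 0"
      using powser_0_nonzero[of r 0 "fps_nth H" "eval_fps H" m, OF r(1) sums H0 m \<open>m > 0\<close>] by blast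
    obtain e where e: "e > 0" "\<And>x. dist x 0 < e \<Longrightarrow> eval_fps H x = 0"
      using ev unfolding eventually_nhds_metric by blast
    define z where "z = min s (e / 2)"
    have "z > 0" "z \<le> s" "z < e"
      using s(1) e(1) by (auto simp: z_def)
    then show False
      using s(2)[of z] e(2)[of z] by (simp add: dist_norm)
  qed
  then have "H = 0" by (simp add: fps_eq_iff)
  then show ?thesis by (simp add: H_def)
qed

lemma prob_deg_stirling2_eqI:
  assumes F: "(\<lambda>t. 1 / fact k * ((LINT \<omega>|M. deg_exp lam (Y \<omega>) t) - 1) ^ k) has_fps_expansion F"
  shows "prob_deg_stirling2 M Y lam n k = fact n * fps_nth F n"
proof -
  have "(THE F. (\<lambda>t. 1 / fact k * ((LINT \<omega>|M. deg_exp lam (Y \<omega>) t) - 1) ^ k) has_fps_expansion F) = F"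
    by (rule the_equality[where P = "\<lambda>F. _ has_fps_expansion F", OF F has_fps_expansion_unique_real[OF _ F]])
  then show ?thesis
    by (simp only: prob_deg_stirling2_def)
qed

end

theory Submission
  imports Defs "HOL-Complex_Analysis.Laurent_Convergence"
begin

text \<open>With \<open>s = ln (1 + lam * t) / lam\<close> the normal moment generating function gives
  \<open>E[deg_exp lam Y t] = exp (s\<^sup>2 / 2)\<close>, so \<open>(exp (s\<^sup>2 / 2) - 1) ^ k\<close> is a signed binomial
  combination of the functions \<open>exp (l * s\<^sup>2 / 2)\<close>, each a series in even powers of \<open>s\<close>.
  The coefficient of \<open>t ^ n\<close> in \<open>s ^ i\<close> comes from comparing coefficients of \<open>x ^ i\<close> in
  \<open>deg_exp lam x t = exp (x * s)\<close>. The series are composed over the complex numbers and then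
  restricted to the real line by taking real parts.\<close>

section \<open>Passing from complex to real power series\<close>

text \<open>At real \<open>t\<close> the powers \<open>t ^ n\<close> are real, so taking real parts
  of a convergent complex series acts on the coefficients alone.\<close>

lemma has_fps_expansion_Re:
  fixes f :: "complex \<Rightarrow> complex" and g :: "real \<Rightarrow> real"
  assumes f: "f has_fps_expansion F"
    and g: "eventually (\<lambda>t. g t = Re (f (of_real t))) (nhds 0)"
  shows "g has_fps_expansion Abs_fps (\<lambda>n. Re (fps_nth F n))"
proof -
  let ?G = "Abs_fps (\<lambda>n. Re (fps_nth F n))"
  have radius: "fps_conv_radius F > 0" and ev: "eventually (\<lambda>z. eval_fps F z = f z) (nhds 0)"
    using f by (auto simp: has_fps_expansion_def)
  have sums: "(\<lambda>n. fps_nth ?G n * t ^ n) sums Re (eval_fps F (of_real t))"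
    if "ereal \<bar>t\<bar> < fps_conv_radius F" for t
  proof -
    have "(\<lambda>n. Re (fps_nth F n * of_real t ^ n)) sums Re (eval_fps F (of_real t))"
      by (intro sums_Re sums_eval_fps) (use that in simp)
    then show ?thesis
      by (simp flip: of_real_power)
  qed
  obtain r where r: "r > 0" "ereal r < fps_conv_radius F"
    using ereal_dense2[OF radius] by (auto simp: zero_ereal_def)
  \<comment> \<open>Convergence at a single positive point \<open>r\<close> already bounds the
    radius of convergence from below by \<open>r\<close>.\<close>
  have "summable (\<lambda>n. fps_nth ?G n * r ^ n)"
    using sums[of r] r by (auto simp: sums_iff)
  then have "ereal r \<le> fps_conv_radius ?G"
    using r(1) conv_radius_geI[of "fps_nth ?G" r] by (simp add: fps_conv_radius_def)
  then have radius': "fps_conv_radius ?G > 0"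
    using r(1) less_le_trans[of 0 "ereal r"] by simp
  have "eventually (\<lambda>t::real. eval_fps F (of_real t) = f (of_real t)) (nhds 0)"
  proof -
    have "filterlim (of_real :: real \<Rightarrow> complex) (nhds 0) (nhds 0)"
      by (rule tendsto_eq_intros filterlim_ident refl)+ simp
    then show ?thesis
      using ev by (rule eventually_compose_filterlim[rotated])
  qed
  moreover have "eventually (\<lambda>t::real. t \<in> {-r<..<r}) (nhds 0)"
    using r(1) by (intro eventually_nhds_in_open) auto
  ultimately have "eventually (\<lambda>t. eval_fps ?G t = g t) (nhds 0)"
    using g
  proof eventually_elim
    case (elim t)
    have "ereal \<bar>t\<bar> < ereal r" using elim(2) by auto
    also note r(2)
    finally have "(\<lambda>n. fps_nth ?G n * t ^ n) sums Re (eval_fps F (of_real t))"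
      by (rule sums)
    then show ?case
      using elim by (simp add: eval_fps_def sums_iff)
  qed
  with radius' show ?thesis
    by (simp add: has_fps_expansion_def)
qed

section \<open>Powers of the degenerate logarithm and Stirling numbers\<close>

text \<open>Expand each falling factorial in powers of \<open>x\<close> and exchange the sums.
  Padding the triangle \<open>i \<le> m \<le> n\<close> with zeros to a square makes the exchange
  immediate.\<close>

lemma deg_falling_fact_conv_power:
  "deg_falling_fact lam x n =
    (\<Sum>i\<le>n. (\<Sum>m=i..n. signed_stirling1 m i * deg_stirling2 lam n m) * x ^ i)"
proof -
  have "deg_falling_fact lam x n =
      (\<Sum>m\<le>n. \<Sum>i\<le>n. if i \<le> m then signed_stirling1 m i * deg_stirling2 lam n m * x ^ i else 0)"
    unfolding deg_falling_fact_conv_deg_stirling2[of lam x n] falling_fact_conv_signed_stirling1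
      sum_distrib_left
    by (intro sum.cong sum.mono_neutral_cong_left) auto
  also have "\<dots> =
      (\<Sum>i\<le>n. \<Sum>m\<le>n. if i \<le> m then signed_stirling1 m i * deg_stirling2 lam n m * x ^ i else 0)"
    by (rule sum.swap)
  also have "\<dots> = (\<Sum>i\<le>n. (\<Sum>m=i..n. signed_stirling1 m i * deg_stirling2 lam n m) * x ^ i)"
    unfolding sum_distrib_right
    by (intro sum.cong refl sum.mono_neutral_cong_right) auto
  finally show ?thesis .
qed

text \<open>The series of \<open>s\<close> as a function of \<open>t\<close>, taken over the complex
  numbers so that analyticity at 0 yields the expansion.\<close>

definition deg_log_fps :: "real \<Rightarrow> complex fps" where
  "deg_log_fps lam = fps_expansion (\<lambda>z. Ln (1 + of_real lam * z) / of_real lam) 0"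

lemma has_fps_expansion_deg_log:
  "(\<lambda>z. Ln (1 + of_real lam * z) / of_real lam) has_fps_expansion deg_log_fps lam"
proof -
  have "(\<lambda>z. Ln (1 + of_real lam * z) / of_real lam) analytic_on {0}"
    \<comment> \<open>For \<open>lam = 0\<close>, division by zero makes the function constantly
      0.\<close>
    by (cases "lam = 0") (auto intro!: analytic_intros)
  then show ?thesis
    unfolding deg_log_fps_def by (rule analytic_at_imp_has_fps_expansion_0)
qed

text \<open>This permits substitution of the series into others and makes its \<open>i\<close>-th
  power start at degree \<open>i\<close> or later.\<close>

lemma deg_log_fps_nth_0 [simp]: "fps_nth (deg_log_fps lam) 0 = 0"
  using has_fps_expansion_imp_0_eq_fps_nth_0[OF has_fps_expansion_deg_log[of lam]] by simp

text \<open>Both sides are coefficients of \<open>(1 + lam * z) powr (x / lam)\<close>, expanded once as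
  \<open>exp (x * Ln (1 + lam * z) / lam)\<close> and once by the binomial series.\<close>

lemma exp_compose_deg_log_fps_nth:
  assumes "lam \<noteq> 0"
  shows "fps_nth (fps_exp (of_real x) oo deg_log_fps lam) n
    = of_real (deg_falling_fact lam x n / fact n)"
proof -
  let ?L = "\<lambda>z. Ln (1 + of_real lam * z) / of_real lam"
  let ?B = "fps_binomial (of_real (x / lam)) oo (fps_const (of_real lam) * fps_X) :: complex fps"
  have "((\<lambda>z. exp (of_real x * z)) \<circ> ?L) has_fps_expansion (fps_exp (of_real x) oo deg_log_fps lam)"
    by (intro has_fps_expansion_compose has_fps_expansion_exp has_fps_expansion_deg_log) simp
  moreover have "((\<lambda>z. exp (of_real x * z)) \<circ> ?L) has_fps_expansion ?B"
  proof -
    have "((\<lambda>z. (1 + z) powr of_real (x / lam)) \<circ> (\<lambda>z. of_real lam * z)) has_fps_expansion ?B"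
      by (intro has_fps_expansion_compose has_fps_expansion_binomial_complex
          has_fps_expansion_cmult_left has_fps_expansion_fps_X) simp
    moreover have "eventually (\<lambda>z. ((\<lambda>z. exp (of_real x * z)) \<circ> ?L) z =
        ((\<lambda>z. (1 + z) powr of_real (x / lam)) \<circ> (\<lambda>z. of_real lam * z)) z) (nhds (0 :: complex))"
    proof -
      \<comment> \<open>The only zero of \<open>1 + lam * z\<close> has modulus
        \<open>1 / \<bar>lam\<bar>\<close>. It must be avoided because \<open>powr\<close> with base
        0 is 0 by convention, not an exponential.\<close>
      have "eventually (\<lambda>z. z \<in> ball 0 (1 / \<bar>lam\<bar>)) (nhds (0 :: complex))"
        using assms by (intro eventually_nhds_in_open) auto
      then show ?thesis
      proof eventually_elim
        case (elim z)
        have "1 + of_real lam * z \<noteq> 0"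
        proof
          assume "1 + of_real lam * z = 0"
          then have "norm (of_real lam * z) = norm (-1 :: complex)"
            by (metis add_eq_0_iff)
          then show False
            using elim assms by (simp add: norm_mult field_simps)
        qed
        then show ?case
          by (simp add: powr_def)
      qed
    qed
    ultimately show ?thesis
      using has_fps_expansion_cong by blast
  qed
  ultimately have "fps_exp (of_real x) oo deg_log_fps lam = ?B"
    by (rule fps_expansion_unique_complex)
  also have "fps_nth ?B n = of_real lam ^ n * (of_real (x / lam) gchoose n)"
    by simp
  \<comment> \<open>One factor \<open>lam\<close> goes to each of the \<open>n\<close> factors of
    the generalized binomial coefficient.\<close>
  also have "\<dots> = of_real ((\<Prod>i<n. lam * (x / lam - real i)) / fact n)"
    by (simp add: gbinomial_prod_rev prod.distrib atLeast0LessThan)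
  also have "(\<Prod>i<n. lam * (x / lam - real i)) = deg_falling_fact lam x n"
    unfolding deg_falling_fact_def
    using assms by (intro prod.cong refl) (simp add: right_diff_distrib mult.commute)
  finally show ?thesis .
qed

text \<open>For fixed \<open>n\<close>, the coefficient of \<open>t ^ n\<close> in
  \<open>exp (x * s)\<close>, the sum of \<open>x ^ i * s ^ i / i!\<close>, is a polynomial in
  \<open>x\<close> of degree at most \<open>n\<close>. It equals
  \<open>deg_falling_fact lam x n / fact n\<close> for all real \<open>x\<close>, so the
  coefficients of \<open>x ^ i\<close> agree.\<close>

lemma Re_deg_log_fps_power_nth:
  assumes "lam \<noteq> 0" "i \<le> n"
  shows "fact n * Re (fps_nth (deg_log_fps lam ^ i) n)
    = fact i * (\<Sum>m=i..n. signed_stirling1 m i * deg_stirling2 lam n m)"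
proof -
  have "(\<Sum>i\<le>n. (fact n * Re (fps_nth (deg_log_fps lam ^ i) n) / fact i) * x ^ i) =
      (\<Sum>i\<le>n. (\<Sum>m=i..n. signed_stirling1 m i * deg_stirling2 lam n m) * x ^ i)" for x
  proof -
    have "deg_falling_fact lam x n / fact n
        = Re (fps_nth (fps_exp (of_real x) oo deg_log_fps lam) n)"
      by (simp only: exp_compose_deg_log_fps_nth[OF assms(1)] Re_complex_of_real)
    also have "\<dots> = (\<Sum>i\<le>n. Re (of_real (x ^ i / fact i) * fps_nth (deg_log_fps lam ^ i) n))"
      by (simp add: fps_compose_nth atLeast0AtMost)
    also have "\<dots> = (\<Sum>i\<le>n. Re (fps_nth (deg_log_fps lam ^ i) n) / fact i * x ^ i)"
      by (simp only: Re_complex_of_real times_complex.sel Im_complex_of_real) (simp add: mult_ac)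
    finally have "fact n * (deg_falling_fact lam x n / fact n) =
        (\<Sum>i\<le>n. fact n * (Re (fps_nth (deg_log_fps lam ^ i) n) / fact i * x ^ i))"
      by (simp only: sum_distrib_left)
    then show ?thesis
      by (simp add: deg_falling_fact_conv_power mult.assoc)
  qed
  then have "fact n * Re (fps_nth (deg_log_fps lam ^ i) n) / fact i
      = (\<Sum>m=i..n. signed_stirling1 m i * deg_stirling2 lam n m)"
    using assms(2) by (rule falling_fact_coeffs_unique)
  then show ?thesis
    by (simp add: field_simps)
qed

section \<open>The expectation for a standard normal variable\<close>

text \<open>Completing the square turns the integrand into \<open>exp (s\<^sup>2 / 2)\<close> times
  the normal density with mean \<open>s\<close>, which has integral 1.\<close>

lemma (in prob_space) std_normal_mgf:
  assumes "distributed M lborel Y std_normal_density"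
  shows "expectation (\<lambda>\<omega>. exp (s * Y \<omega>)) = exp (s\<^sup>2 / 2)"
proof -
  have "std_normal_density y * exp (s * y) = exp (s\<^sup>2 / 2) * normal_density s 1 y" for y
  proof -
    have "exp (- y\<^sup>2 / 2) * exp (s * y) = exp (s\<^sup>2 / 2) * exp (- (y - s)\<^sup>2 / 2)"
      by (simp add: power2_eq_square algebra_simps add_divide_distrib diff_divide_distrib flip: exp_add)
    then show ?thesis
      by (simp add: normal_density_def)
  qed
  then have "(\<integral>y. std_normal_density y * exp (s * y) \<partial>lborel) = exp (s\<^sup>2 / 2)"
    by simp
  then show ?thesis
    using distributed_integral[OF assms, of "\<lambda>y. exp (s * y)"] by simp
qed

lemma expectation_deg_exp_std_normal:
  assumes "prob_space M" "distributed M lborel Y std_normal_density" "1 + lam * t > 0"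
  shows "(LINT \<omega>|M. deg_exp lam (Y \<omega>) t) = exp ((ln (1 + lam * t) / lam)\<^sup>2 / 2)"
proof -
  interpret prob_space M by fact
  have "deg_exp lam (Y \<omega>) t = exp (ln (1 + lam * t) / lam * Y \<omega>)" for \<omega>
    using assms(3) by (simp add: deg_exp_def powr_def mult.commute)
  then show ?thesis
    using std_normal_mgf[OF assms(2), of "ln (1 + lam * t) / lam"] by simp
qed

section \<open>Series in even powers of the degenerate logarithm\<close>

text \<open>For real \<open>t\<close> near 0 the argument \<open>1 + lam * t\<close> is positive, so
  \<open>Ln\<close> agrees with \<open>ln\<close> and the complex composition takes real
  values.\<close>

lemma has_fps_expansion_exp_deg_log_square:
  "(\<lambda>t. exp (c * (ln (1 + lam * t) / lam)\<^sup>2)) has_fps_expansion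
    Abs_fps (\<lambda>n. Re (fps_nth (fps_exp (of_real c) oo deg_log_fps lam ^ 2) n))"
proof (rule has_fps_expansion_Re)
  let ?L = "\<lambda>z. Ln (1 + of_real lam * z) / of_real lam"
  show "((\<lambda>z. exp (of_real c * z)) \<circ> (\<lambda>z. ?L z * ?L z)) has_fps_expansion
      (fps_exp (of_real c) oo deg_log_fps lam ^ 2)"
    unfolding power2_eq_square
    by (intro has_fps_expansion_compose has_fps_expansion_exp has_fps_expansion_mult
        has_fps_expansion_deg_log) simp
  have "eventually (\<lambda>t. 1 + lam * t > 0) (nhds 0)"
    by (intro order_tendstoD(1)[of _ 1]) (auto intro!: tendsto_eq_intros filterlim_ident)
  then show "eventually (\<lambda>t. exp (c * (ln (1 + lam * t) / lam)\<^sup>2) =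
      Re (((\<lambda>z. exp (of_real c * z)) \<circ> (\<lambda>z. ?L z * ?L z)) (of_real t))) (nhds 0)"
  proof eventually_elim
    case (elim t)
    have "Ln (1 + of_real lam * of_real t) = of_real (ln (1 + lam * t))"
      using Ln_of_real[OF elim] by simp
    then have "((\<lambda>z. exp (of_real c * z)) \<circ> (\<lambda>z. ?L z * ?L z)) (of_real t)
        = exp (of_real (c * (ln (1 + lam * t) / lam)\<^sup>2))"
      by (simp add: power2_eq_square)
    then show ?case
      by (simp only: exp_of_real Re_complex_of_real)
  qed
qed

text \<open>The \<open>j\<close>-th term of the exponential series contributes
  \<open>s ^ (2 * j)\<close>, whose coefficients are known from
  \<open>Re_deg_log_fps_power_nth\<close>; this is where \<open>fact (2 * j)\<close> enters.\<close>

lemma exp_compose_deg_log_square_nth: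
  assumes "lam \<noteq> 0"
  shows "fact n * Re (fps_nth (fps_exp (of_real (c / 2)) oo deg_log_fps lam ^ 2) n) =
    (\<Sum>j=0..n div 2. c ^ j * fact (2 * j) / (2 ^ j * fact j) *
      (\<Sum>m=2*j..n. signed_stirling1 m (2 * j) * deg_stirling2 lam n m))"
proof -
  have "Re (fps_nth (fps_exp (of_real (c / 2)) oo deg_log_fps lam ^ 2) n)
      = (\<Sum>j=0..n. Re (of_real ((c / 2) ^ j / fact j) * fps_nth (deg_log_fps lam ^ (2 * j)) n))"
    by (simp add: fps_compose_nth power_mult)
  also have "\<dots> = (\<Sum>j=0..n. (c / 2) ^ j / fact j * Re (fps_nth (deg_log_fps lam ^ (2 * j)) n))"
    by (simp only: Re_complex_of_real times_complex.sel Im_complex_of_real) simp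
  \<comment> \<open>If \<open>2 * j > n\<close>, the power has no term of degree \<open>n\<close>,
    since \<open>deg_log_fps lam\<close> has constant term 0.\<close>
  also have "\<dots> = (\<Sum>j=0..n div 2. (c / 2) ^ j / fact j * Re (fps_nth (deg_log_fps lam ^ (2 * j)) n))"
    by (intro sum.mono_neutral_right) (auto simp: startsby_zero_power_prefix)
  also have "fact n * \<dots> = (\<Sum>j=0..n div 2. (c / 2) ^ j / fact j *
      (fact n * Re (fps_nth (deg_log_fps lam ^ (2 * j)) n)))"
    by (simp add: sum_distrib_left mult_ac)
  also have "\<dots> = (\<Sum>j=0..n div 2. c ^ j * fact (2 * j) / (2 ^ j * fact j) *
      (\<Sum>m=2*j..n. signed_stirling1 m (2 * j) * deg_stirling2 lam n m))"
    using Re_deg_log_fps_power_nth[OF assms]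
    by (intro sum.cong refl) (auto simp: power_divide)
  finally show ?thesis .
qed

section \<open>Binomial expansion of the \<open>k\<close>-th power\<close>

theorem theorem3p2:
  fixes M :: "'a measure" and Y :: "'a \<Rightarrow> real" and lam :: real and n k :: nat
  assumes "prob_space M"
    and "distributed M lborel Y std_normal_density"
    and "lam \<noteq> 0"
    and "k \<le> n"
  shows "prob_deg_stirling2 M Y lam n k =
    1 / fact k * (\<Sum>l=0..k. real (k choose l) * (- 1) ^ (k - l) *
      (\<Sum>j=0..n div 2. real l ^ j * fact (2 * j) / (2 ^ j * fact j) *
        (\<Sum>m=2*j..n. signed_stirling1 m (2 * j) * deg_stirling2 lam n m)))"
proof -
  \<comment> \<open>\<open>G l\<close> is the real series of
    \<open>exp (l * s\<^sup>2 / 2)\<close>.\<close>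
  define G where "G l = Abs_fps (\<lambda>n. Re (fps_nth
    (fps_exp (of_real (real l / 2)) oo deg_log_fps lam ^ 2) n))" for l
  define F where "F = fps_const (1 / fact k) *
    (\<Sum>l=0..k. fps_const (real (k choose l) * (- 1) ^ (k - l)) * G l)"
  have "(\<lambda>t. 1 / fact k * (\<Sum>l=0..k. real (k choose l) * (- 1) ^ (k - l) *
      exp (real l / 2 * (ln (1 + lam * t) / lam)\<^sup>2))) has_fps_expansion F"
    unfolding F_def G_def
    by (intro has_fps_expansion_cmult_left has_fps_expansion_sum has_fps_expansion_exp_deg_log_square)
  moreover have "eventually (\<lambda>t. 1 / fact k * ((LINT \<omega>|M. deg_exp lam (Y \<omega>) t) - 1) ^ k =
      1 / fact k * (\<Sum>l=0..k. real (k choose l) * (- 1) ^ (k - l) *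
        exp (real l / 2 * (ln (1 + lam * t) / lam)\<^sup>2))) (nhds 0)"
  proof -
    have "eventually (\<lambda>t. 1 + lam * t > 0) (nhds 0)"
      by (intro order_tendstoD(1)[of _ 1]) (auto intro!: tendsto_eq_intros filterlim_ident)
    then show ?thesis
    proof eventually_elim
      case (elim t)
      define s where "s = ln (1 + lam * t) / lam"
      have "((LINT \<omega>|M. deg_exp lam (Y \<omega>) t) - 1) ^ k = (exp (s\<^sup>2 / 2) + (- 1)) ^ k"
        using expectation_deg_exp_std_normal[OF assms(1,2) elim] by (simp add: s_def)
      also have "\<dots> = (\<Sum>l=0..k. real (k choose l) * exp (s\<^sup>2 / 2) ^ l * (- 1) ^ (k - l))"
        by (simp only: binomial_ring atLeast0AtMost)
      also have "\<dots> = (\<Sum>l=0..k. real (k choose l) * (- 1) ^ (k - l) * exp (real l / 2 * s\<^sup>2))"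
        by (intro sum.cong refl) (simp flip: exp_of_nat_mult)
      finally show ?case
        by (simp add: s_def)
    qed
  qed
  \<comment> \<open>An expansion at 0 depends only on the values of the function near 0.\<close>
  ultimately have "(\<lambda>t. 1 / fact k * ((LINT \<omega>|M. deg_exp lam (Y \<omega>) t) - 1) ^ k) has_fps_expansion F"
    by (rule iffD2[OF has_fps_expansion_cong[OF _ refl], rotated])
  then have "prob_deg_stirling2 M Y lam n k = fact n * fps_nth F n"
    by (rule prob_deg_stirling2_eqI)
  also have "\<dots> = 1 / fact k * (\<Sum>l=0..k. real (k choose l) * (- 1) ^ (k - l) *
      (fact n * fps_nth (G l) n))"
    by (simp add: F_def fps_sum_nth sum_distrib_left mult_ac)
  finally show ?thesis
    by (simp only: G_def fps_nth_Abs_fps exp_compose_deg_log_square_nth[OF assms(3)])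
qed

end
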